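(* Every path of cycles is sc-greedy. That is, if $G$ is a path of $k$ cycles for some $k\ge 1$, then $\chi_{SC}(G)=|V(G)|+|E(G)|$.
   Context: Graphs are finite and simple. For a graph $G=(V,E)$, a size function is a map $f:V\to\mathbb{N}$. An $f$-assignment is a map $L:V\to 2^{\mathbb{N}}$ assigning to each vertex $v$ a list (finite set) of colors with $|L(v)|=f(v)$. $G$ is $L$-colorable if there is a proper coloring $c$ of $G$ with $c(v)\in L(v)$ for all $v\in V$. $G$ is $f$-choosable, and $f$ is called a choice function for $G$, if $G$ is $L$-colorable for every $f$-assignment $L$. Put $\operatorname{size}(f)=\sum_{v\in V}f(v)$. The sum choice number $\chi_{SC}(G)$ is the minimum of $\operatorname{size}(f)$ over all choice functions $f$ for $G$. $G$ is sc-greedy if $\chi_{SC}(G)=|V(G)|+|E(G)|$. The weak dual of a plane graph is its dual graph with the vertex corresponding to the unbounded face removed. A graph $G$ is called a path of $k$ cycles (or path of cycles) if $G=\bigcup_{i=1}^k G_i$ where: (1) each $G_i$ is a cycle of length $a_i\ge 4$, for $i=1,\ldots,k$; (2) $V(G_{i-1})\cap V(G_i)=\{t_i,b_i\}$ (two distinct vertices) for all $i=2,\ldots,k$; (3) $E(G_{i-1})\cap E(G_i)=\{t_ib_i\}$ for all $i=2,\ldots,k$; (4) $t_i,b_i\notin V(G_j)$ for all $j\ne i-1,i$ (for $i=2,\ldots,k$); (5) if $w_i\in V(G_i)-\{t_i,b_i,t_{i+1},b_{i+1}\}$, then $w_i\notin V(G_j)$ for $j\ne i$ (where $t_1,b_1,t_{k+1},b_{k+1}$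 do not exist and are ignored); (6) $G$ can be drawn in the plane so that the weak dual of $G$ is a path. *)

theory Defs
  imports "HOL-Analysis.Analysis"
begin

section \<open>Graphs\<close>

record 'a ugraph =
  verts :: "'a set"
  edges :: "'a set set"

definition simple_graph :: "'a ugraph \<Rightarrow> bool" where
  "simple_graph G \<longleftrightarrow>
     finite (verts G) \<and> (\<forall>e \<in> edges G. e \<subseteq> verts G \<and> card e = 2)"

definition cycle_graph :: "nat \<Rightarrow> 'a ugraph \<Rightarrow> bool" where
  "cycle_graph n C \<longleftrightarrow> n \<ge> 3 \<and>
     (\<exists>xs. length xs = n \<and> distinct xs \<and> verts C = set xs \<and>
        edges C = {{xs ! j, xs ! (Suc j mod n)} | j. j < n})"


section \<open>Sum choice number\<close>

definition proper_coloring :: "'a ugraph \<Rightarrow> ('a \<Rightarrow> nat) \<Rightarrow> bool" where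
  "proper_coloring G c \<longleftrightarrow> (\<forall>u v. {u, v} \<in> edges G \<longrightarrow> c u \<noteq> c v)"

definition list_assignment :: "'a ugraph \<Rightarrow> ('a \<Rightarrow> nat) \<Rightarrow> ('a \<Rightarrow> nat set) \<Rightarrow> bool" where
  "list_assignment G f L \<longleftrightarrow> (\<forall>v \<in> verts G. finite (L v) \<and> card (L v) = f v)"

definition list_colorable :: "'a ugraph \<Rightarrow> ('a \<Rightarrow> nat set) \<Rightarrow> bool" where
  "list_colorable G L \<longleftrightarrow> (\<exists>c. proper_coloring G c \<and> (\<forall>v \<in> verts G. c v \<in> L v))"

definition choice_function :: "'a ugraph \<Rightarrow> ('a \<Rightarrow> nat) \<Rightarrow> bool" where
  "choice_function G f \<longleftrightarrow> (\<forall>L. list_assignment G f L \<longrightarrow> list_colorable G L)"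

definition fun_size :: "'a ugraph \<Rightarrow> ('a \<Rightarrow> nat) \<Rightarrow> nat" where
  "fun_size G f = (\<Sum>v \<in> verts G. f v)"

text \<open>
  The minimum is attained for every finite simple graph, since the constant function with value
  \<open>card (verts G)\<close> is a choice function.
\<close>
definition sum_choice_number :: "'a ugraph \<Rightarrow> nat" where
  "sum_choice_number G = (LEAST s. \<exists>f. choice_function G f \<and> s = fun_size G f)"

definition sc_greedy :: "'a ugraph \<Rightarrow> bool" where
  "sc_greedy G \<longleftrightarrow> sum_choice_number G = card (verts G) + card (edges G)"


section \<open>Plane drawings and weak duals\<close>

text \<open>
  A drawing places each vertex \<open>v\<close> at \<open>p v\<close> and each edge \<open>e\<close> along a Jordan arc \<open>g e\<close>.
\<close>
definition plane_drawing ::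
    "'a ugraph \<Rightarrow> ('a \<Rightarrow> complex) \<Rightarrow> ('a set \<Rightarrow> real \<Rightarrow> complex) \<Rightarrow> bool" where
  "plane_drawing G p g \<longleftrightarrow>
     inj_on p (verts G) \<and>
     (\<forall>e \<in> edges G. arc (g e) \<and> {pathstart (g e), pathfinish (g e)} = p ` e \<and>
        path_image (g e) \<inter> p ` verts G = p ` e) \<and>
     (\<forall>e \<in> edges G. \<forall>e' \<in> edges G. e \<noteq> e' \<longrightarrow>
        path_image (g e) \<inter> path_image (g e') \<subseteq> p ` (e \<inter> e'))"

definition plane_faces ::
    "'a ugraph \<Rightarrow> ('a \<Rightarrow> complex) \<Rightarrow> ('a set \<Rightarrow> real \<Rightarrow> complex) \<Rightarrow> complex set set" where
  "plane_faces G p g = components (- (p ` verts G \<union> (\<Union>e \<in> edges G. path_image (g e))))"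

text \<open>
  The dual is a multigraph whose edges are the edges of \<open>G\<close>; the dual edge of \<open>e\<close> joins the faces
  having \<open>e\<close> on their boundary. These are the two faces on either side of \<open>e\<close>; if both sides
  belong to one face, the set below is a singleton and the dual edge is a loop.
\<close>
definition dual_ends ::
    "'a ugraph \<Rightarrow> ('a \<Rightarrow> complex) \<Rightarrow> ('a set \<Rightarrow> real \<Rightarrow> complex) \<Rightarrow> 'a set \<Rightarrow> complex set set" where
  "dual_ends G p g e = {F \<in> plane_faces G p g. path_image (g e) \<subseteq> frontier F}"

definition weak_dual_verts ::
    "'a ugraph \<Rightarrow> ('a \<Rightarrow> complex) \<Rightarrow> ('a set \<Rightarrow> real \<Rightarrow> complex) \<Rightarrow> complex set set" where
  "weak_dual_verts G p g = {F \<in> plane_faces G p g. bounded F}"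

definition weak_dual_edges ::
    "'a ugraph \<Rightarrow> ('a \<Rightarrow> complex) \<Rightarrow> ('a set \<Rightarrow> real \<Rightarrow> complex) \<Rightarrow> 'a set set" where
  "weak_dual_edges G p g = {e \<in> edges G. dual_ends G p g e \<subseteq> weak_dual_verts G p g}"

text \<open>
  A multigraph with vertex set \<open>W\<close>, edge set \<open>D\<close> and end-vertex map \<open>ends\<close> is a path (possibly
  consisting of a single vertex). Bijectivity of \<open>ends\<close> excludes parallel edges.
\<close>
definition is_path_multigraph :: "'b set \<Rightarrow> 'c set \<Rightarrow> ('c \<Rightarrow> 'b set) \<Rightarrow> bool" where
  "is_path_multigraph W D ends \<longleftrightarrow>
     (\<exists>xs. xs \<noteq> [] \<and> distinct xs \<and> set xs = W \<and>
        bij_betw ends D {{xs ! j, xs ! Suc j} | j. Suc j < length xs})"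


section \<open>Paths of cycles\<close>

text \<open>
  The graphs \<open>C 1, \<dots>, C k\<close> are the cycles, of lengths \<open>a 1, \<dots>, a k\<close>; \<open>t i\<close> and \<open>b i\<close> are
  the vertices shared by \<open>C (i - 1)\<close> and \<open>C i\<close>, meaningful only for \<open>2 \<le> i \<le> k\<close>.
\<close>
definition path_of_cycles :: "nat \<Rightarrow> 'a ugraph \<Rightarrow> bool" where
  "path_of_cycles k G \<longleftrightarrow>
     (\<exists>(C :: nat \<Rightarrow> 'a ugraph) (a :: nat \<Rightarrow> nat) (t :: nat \<Rightarrow> 'a) (b :: nat \<Rightarrow> 'a).
        verts G = (\<Union>i \<in> {1..k}. verts (C i)) \<and>
        edges G = (\<Union>i \<in> {1..k}. edges (C i)) \<and>
        (\<forall>i \<in> {1..k}. a i \<ge> 4 \<and> cycle_graph (a i) (C i)) \<and>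
        (\<forall>i \<in> {2..k}. t i \<noteq> b i \<and> verts (C (i - 1)) \<inter> verts (C i) = {t i, b i}) \<and>
        (\<forall>i \<in> {2..k}. edges (C (i - 1)) \<inter> edges (C i) = {{t i, b i}}) \<and>
        (\<forall>i \<in> {2..k}. \<forall>j \<in> {1..k} - {i - 1, i}. t i \<notin> verts (C j) \<and> b i \<notin> verts (C j)) \<and>
        (\<forall>i \<in> {1..k}. \<forall>w \<in> verts (C i) - (\<Union>l \<in> {i, i + 1} \<inter> {2..k}. {t l, b l}).
           \<forall>j \<in> {1..k} - {i}. w \<notin> verts (C j))) \<and>
     (\<exists>p g. plane_drawing G p g \<and>
        is_path_multigraph (weak_dual_verts G p g) (weak_dual_edges G p g) (dual_ends G p g))"

end

theory Submission
  imports Defs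
begin

text \<open>
  Coloring greedily shows that the sum choice number is at most \<open>|V| + |E|\<close> for every graph. The
  lower bound says that a size function \<open>f\<close> of total size below \<open>|V| + |E|\<close> admits lists without a
  proper coloring. Such lists are built while \<open>G\<close> is swept from its first cycle to its last one.

  Consecutive cycles meet in an edge, and the two edges in which a cycle meets its neighbors are
  disjoint. Hence, once an edge has been chosen in each of the two extremal cycles (this is possible
  because they have length at least 4), \<open>G\<close> looks like a ladder with subdivided rails: it starts
  from one edge and grows by two kinds of steps. Either a vertex is attached to one of the two
  frontier vertices \<open>u\<close>, \<open>v\<close> and replaces it, or a rung is added, that is, an edge whose ends are
  attached to \<open>u\<close> and \<open>v\<close>, respectively, and replace them.

  Let the excess of the swept part \<open>S\<close> be the size of \<open>f\<close> on \<open>S\<close> minus the number of vertices and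
  edges of the subgraph that \<open>S\<close> induces. The invariant (\<open>controlled\<close>) is that lists of the
  prescribed sizes can be put on \<open>S\<close> such that the colors of \<open>u\<close> and \<open>v\<close> are restricted as follows,
  for suitable \<open>\<alpha> \<noteq> \<beta>\<close>: if the excess is at most 1, every coloring gives \<open>u\<close> the color \<open>\<alpha>\<close> or \<open>v\<close>
  the color \<open>\<beta>\<close>; if it is at most 0, every coloring does both; if it is negative, there is no
  coloring. Whether the lists of the new vertices can be chosen so that the invariant survives is a
  question about sets of pairs of colors alone, answered in \<open>restricts_extend_pairs\<close> and
  \<open>restricts_rung_pairs\<close>.
  At the end of the sweep \<open>S\<close> is the whole vertex set, and a choice function therefore has
  nonnegative excess, that is, size at least \<open>|V| + |E|\<close>.
\<close>


section \<open>Pairs of colors on a frontier\<close>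

text \<open>
  \<open>R\<close> is meant as the set of color pairs that the colorings of the swept part induce on its frontier,
  and \<open>n\<close> as its excess. Every unit of excess that is missing buys one level of restriction.
  Distinctness of \<open>\<alpha>\<close> and \<open>\<beta>\<close> lets \<open>{\<alpha>, \<beta>}\<close> serve as a list of two colors in the next step.
\<close>
definition restricts :: "int \<Rightarrow> (nat \<times> nat) set \<Rightarrow> bool" where
  "restricts n R \<longleftrightarrow>
     (n \<le> -1 \<longrightarrow> R = {}) \<and>
     (n \<le> 0 \<longrightarrow> (\<exists>\<alpha> \<beta>. \<alpha> \<noteq> \<beta> \<and> R \<subseteq> {(\<alpha>, \<beta>)})) \<and>
     (n \<le> 1 \<longrightarrow> (\<exists>\<alpha> \<beta>. \<alpha> \<noteq> \<beta> \<and> (\<forall>(p, q) \<in> R. p = \<alpha> \<or> q = \<beta>)))"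

lemma restricts_empty: "restricts n {}"
  unfolding restricts_def by (auto intro: exI[of _ "0::nat"] exI[of _ "1::nat"])

lemma restricts_singleton:
  assumes "R \<subseteq> {(\<alpha>, \<beta>)}" "\<alpha> \<noteq> \<beta>" "0 \<le> n"
  shows "restricts n R"
  unfolding restricts_def
  by (intro conjI impI exI[of _ \<alpha>] exI[of _ \<beta>]) (use assms in auto)

lemma restricts_disjunction:
  assumes "\<And>p q. (p, q) \<in> R \<Longrightarrow> p = \<alpha> \<or> q = \<beta>" "\<alpha> \<noteq> \<beta>" "1 \<le> n"
  shows "restricts n R"
  unfolding restricts_def
  by (intro conjI impI exI[of _ \<alpha>] exI[of _ \<beta>]) (use assms in auto)

lemma restricts_trivial: "2 \<le> n \<Longrightarrow> restricts n R"
  unfolding restricts_def by auto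

lemma restricts_cases:
  assumes "restricts n R"
  obtains (empty) "R = {}"
  | (singleton) \<alpha> \<beta> where "n = 0" "\<alpha> \<noteq> \<beta>" "R \<subseteq> {(\<alpha>, \<beta>)}"
  | (disjunction) \<alpha> \<beta> where "n = 1" "\<alpha> \<noteq> \<beta>" "\<And>p q. (p, q) \<in> R \<Longrightarrow> p = \<alpha> \<or> q = \<beta>"
  | (trivial) "2 \<le> n"
proof -
  consider "n \<le> -1" | "n = 0" | "n = 1" | "2 \<le> n" by linarith
  then show thesis
  proof cases
    case 1 then show thesis using assms empty unfolding restricts_def by blast
  next
    case 2 then show thesis using assms singleton unfolding restricts_def by auto
  next
    case 3
    with assms obtain \<alpha> \<beta> where "\<alpha> \<noteq> \<beta>" "\<forall>(p, q) \<in> R. p = \<alpha> \<or> q = \<beta>"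
      unfolding restricts_def by auto
    with 3 show thesis by (intro disjunction) auto
  next
    case 4 then show thesis by (rule trivial)
  qed
qed

lemma restricts_mono:
  assumes "restricts n R" "R' \<subseteq> R"
  shows "restricts n R'"
  using assms(1)
proof (cases rule: restricts_cases)
  case empty
  then show ?thesis using assms(2) restricts_empty by simp
next
  case singleton
  then show ?thesis using assms(2) by (intro restricts_singleton) auto
next
  case disjunction
  then show ?thesis using assms(2) by (intro restricts_disjunction) auto
next
  case trivial
  then show ?thesis by (rule restricts_trivial)
qed

lemma restricts_converse:
  assumes "restricts n R"
  shows "restricts n (R\<inverse>)"
  using assms
proof (cases rule: restricts_cases)
  case empty
  then show ?thesis using restricts_empty by simp
next
  case (singleton \<alpha> \<beta>)
  then show ?thesis by (intro restricts_singleton[where \<alpha> = \<beta> and \<beta> = \<alpha>]) auto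
next
  case (disjunction \<alpha> \<beta>)
  then show ?thesis by (intro restricts_disjunction[where \<alpha> = \<beta> and \<beta> = \<alpha>]) auto
next
  case trivial
  then show ?thesis by (rule restricts_trivial)
qed

lemma ex_list_of_size: "\<exists>A :: nat set. finite A \<and> card A = m"
  by (intro exI[of _ "{..<m}"]) simp

lemma ex_fresh: "finite (X :: nat set) \<Longrightarrow> \<exists>x. x \<notin> X"
  by (rule ex_new_if_finite[OF infinite_UNIV_nat])

text \<open>
  The pairs left after the first frontier vertex, with its color \<open>p\<close>, is replaced by a neighbor of it
  that has list \<open>A\<close>.
\<close>
definition extend_pairs :: "nat set \<Rightarrow> (nat \<times> nat) set \<Rightarrow> (nat \<times> nat) set" where
  "extend_pairs A R = {(x, q). x \<in> A \<and> (\<exists>p. (p, q) \<in> R \<and> p \<noteq> x)}"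

text \<open>
  A list \<open>{\<alpha>, x}\<close> passes a restriction on: color \<open>\<alpha>\<close> on the old vertex forces color \<open>x\<close> on the new
  one. The list \<open>{\<alpha>}\<close> rules out color \<open>\<alpha>\<close> on the old vertex: no coloring is left if that color was
  forced, and color \<open>\<beta>\<close> becomes forced on the other side if a disjunction held.
  A longer list loses the information about this side, but a color forced on the other side remains.
\<close>
lemma restricts_extend_pairs:
  assumes "restricts n R"
  shows "\<exists>A. finite A \<and> card A = i \<and> restricts (n + int i - 2) (extend_pairs A R)"
    (is "\<exists>A. ?P A")
  using assms
proof (cases rule: restricts_cases)
  case empty
  then have "extend_pairs A R = {}" for A by (auto simp: extend_pairs_def)
  then show ?thesis using ex_list_of_size[of i] restricts_empty by auto
next
  case (singleton \<alpha> \<beta>)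
  obtain x where x: "x \<notin> {\<alpha>, \<beta>}" using ex_fresh[of "{\<alpha>, \<beta>}"] by auto
  consider "i = 0" | "i = 1" | "i = 2" | "3 \<le> i" by linarith
  then show ?thesis
  proof cases
    case 1
    then show ?thesis by (intro exI[of _ "{}"]) (simp add: extend_pairs_def restricts_empty)
  next
    case 2
    have "extend_pairs {\<alpha>} R = {}" using singleton by (auto simp: extend_pairs_def)
    with 2 have "?P {\<alpha>}" by (simp add: restricts_empty)
    then show ?thesis ..
  next
    case 3
    have "extend_pairs {\<alpha>, x} R \<subseteq> {(x, \<beta>)}" using singleton by (auto simp: extend_pairs_def)
    with 3 singleton x have "?P {\<alpha>, x}" by (auto intro: restricts_singleton)
    then show ?thesis ..
  next
    case 4
    obtain A :: "nat set" where A: "finite A" "card A = i" using ex_list_of_size by blast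
    have "restricts (n + int i - 2) (extend_pairs A R)"
      by (rule restricts_disjunction[where \<alpha> = x and \<beta> = \<beta>])
        (use 4 singleton x in \<open>auto simp: extend_pairs_def\<close>)
    with A show ?thesis by blast
  qed
next
  case (disjunction \<alpha> \<beta>)
  obtain x where x: "x \<notin> {\<alpha>, \<beta>}" using ex_fresh[of "{\<alpha>, \<beta>}"] by auto
  consider "i = 0" | "i = 1" | "i = 2" | "3 \<le> i" by linarith
  then show ?thesis
  proof cases
    case 1
    then show ?thesis by (intro exI[of _ "{}"]) (simp add: extend_pairs_def restricts_empty)
  next
    case 2
    have "extend_pairs {\<alpha>} R \<subseteq> {(\<alpha>, \<beta>)}" using disjunction by (auto simp: extend_pairs_def)
    with 2 disjunction have "?P {\<alpha>}" by (auto intro: restricts_singleton)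
    then show ?thesis ..
  next
    case 3
    have "restricts (n + int i - 2) (extend_pairs {\<alpha>, x} R)"
      by (rule restricts_disjunction[where \<alpha> = x and \<beta> = \<beta>])
        (use 3 disjunction x in \<open>auto simp: extend_pairs_def\<close>)
    with 3 x have "?P {\<alpha>, x}" by auto
    then show ?thesis ..
  next
    case 4
    obtain A :: "nat set" where "finite A" "card A = i" using ex_list_of_size by blast
    with 4 disjunction(1) have "?P A" by (auto intro: restricts_trivial)
    then show ?thesis ..
  qed
next
  case trivial
  consider "i = 0" | "i = 1" | "2 \<le> i" by linarith
  then show ?thesis
  proof cases
    case 1
    then show ?thesis by (intro exI[of _ "{}"]) (simp add: extend_pairs_def restricts_empty)
  next
    case 2
    have "restricts (n + int i - 2) (extend_pairs {0} R)"
      by (rule restricts_disjunction[where \<alpha> = 0 and \<beta> = 1])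
        (use 2 trivial in \<open>auto simp: extend_pairs_def\<close>)
    with 2 have "?P {0}" by auto
    then show ?thesis ..
  next
    case 3
    obtain A :: "nat set" where "finite A" "card A = i" using ex_list_of_size by blast
    with 3 trivial have "?P A" by (auto intro: restricts_trivial)
    then show ?thesis ..
  qed
qed

text \<open>
  The pairs left after both frontier vertices are replaced by neighbors of them that have lists \<open>A\<close>
  and \<open>B\<close> and are adjacent to each other.
\<close>
definition rung_pairs :: "nat set \<Rightarrow> nat set \<Rightarrow> (nat \<times> nat) set \<Rightarrow> (nat \<times> nat) set" where
  "rung_pairs A B R = {(x, y). x \<in> A \<and> y \<in> B \<and> x \<noteq> y \<and> (\<exists>(p, q) \<in> R. p \<noteq> x \<and> q \<noteq> y)}"

lemma rung_pairs_converse: "rung_pairs A B (R\<inverse>) = (rung_pairs B A R)\<inverse>"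
  by (auto simp: rung_pairs_def)

text \<open>
  A rung adds two vertices and three edges, which explains the 5. If the old frontier is forced to
  \<open>(\<alpha>, \<beta>)\<close>, lists containing \<open>\<alpha>\<close> and \<open>\<beta>\<close> are in effect shorter by one color each. If the old
  frontier only satisfies a disjunction, \<open>\<alpha>\<close> on the first new vertex together with \<open>\<beta>\<close> on the second
  is impossible: with both lists equal to \<open>{\<alpha>, \<beta>}\<close> the frontier is forced to \<open>(\<beta>, \<alpha>)\<close>, and one
  additional color on one side turns this into a disjunction again. If nothing is known about the old
  frontier, short lists with a common color restrict the ends of the rung by themselves.
\<close>
lemma restricts_rung_pairs_ordered:
  assumes "restricts n R" "i \<le> j"
  shows "\<exists>A B. finite A \<and> card A = i \<and> finite B \<and> card B = j \<and>
           restricts (n + int i + int j - 5) (rung_pairs A B R)"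
    (is "\<exists>A B. ?P A B")
proof -
  obtain A B :: "nat set" where AB: "finite A" "card A = i" "finite B" "card B = j"
    using ex_list_of_size by metis
  \<comment> \<open>With an empty list no pair is left, and for excess at least 2 nothing is required.\<close>
  show ?thesis
  proof (cases "i = 0 \<or> 2 \<le> n + int i + int j - 5")
    case True
    then have "?P A B"
      using AB restricts_empty by (auto intro: restricts_trivial simp: rung_pairs_def)
    then show ?thesis by blast
  next
    case False
    then have i: "0 < i" and small: "n + int i + int j \<le> 6" by auto
    from assms(1) show ?thesis
    proof (cases rule: restricts_cases)
      case empty
      then have "?P A B" using AB restricts_empty by (auto simp: rung_pairs_def)
      then show ?thesis by blast
    next
      case (singleton \<alpha> \<beta>)
      obtain x where x: "x \<notin> {\<alpha>, \<beta>}" using ex_fresh[of "{\<alpha>, \<beta>}"] by auto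
      obtain y where y: "y \<notin> {\<alpha>, \<beta>, x}" using ex_fresh[of "{\<alpha>, \<beta>, x}"] by auto
      obtain z where z: "z \<notin> {\<alpha>, \<beta>, x, y}" using ex_fresh[of "{\<alpha>, \<beta>, x, y}"] by auto
      consider "i = 1" | "i = 2" "j = 2" | "i = 2" "j = 3" | "i = 2" "4 \<le> j" | "i = 3" "j = 3"
        using i small assms(2) singleton(1) by linarith
      then show ?thesis
      proof cases
        case 1
        have "rung_pairs {\<alpha>} B R = {}" using singleton by (auto simp: rung_pairs_def)
        then have "?P {\<alpha>} B" using 1 AB by (simp add: restricts_empty)
        then show ?thesis by blast
      next
        case 2
        have "rung_pairs {\<alpha>, x} {\<beta>, x} R = {}" using singleton by (auto simp: rung_pairs_def)
        then have "?P {\<alpha>, x} {\<beta>, x}" using 2 x by (simp add: restricts_empty)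
        then show ?thesis by blast
      next
        case 3
        have "rung_pairs {\<alpha>, x} {\<beta>, x, y} R \<subseteq> {(x, y)}"
          using singleton by (auto simp: rung_pairs_def)
        then have "?P {\<alpha>, x} {\<beta>, x, y}" using 3 x y singleton
          by (auto intro: restricts_singleton)
        then show ?thesis by blast
      next
        case 4
        have "restricts (n + int i + int j - 5) (rung_pairs {\<alpha>, x} B R)"
          by (rule restricts_disjunction[where \<alpha> = x and \<beta> = y])
            (use 4 singleton y in \<open>auto simp: rung_pairs_def\<close>)
        then have "?P {\<alpha>, x} B" using 4 x AB by auto
        then show ?thesis by blast
      next
        case 5
        have "restricts (n + int i + int j - 5) (rung_pairs {\<alpha>, x, y} {\<beta>, x, z} R)"
          by (rule restricts_disjunction[where \<alpha> = y and \<beta> = z])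
            (use 5 singleton z in \<open>auto simp: rung_pairs_def\<close>)
        then have "?P {\<alpha>, x, y} {\<beta>, x, z}" using 5 x y z by auto
        then show ?thesis by blast
      qed
    next
      case (disjunction \<alpha> \<beta>)
      obtain x where x: "x \<notin> {\<alpha>, \<beta>}" using ex_fresh[of "{\<alpha>, \<beta>}"] by auto
      consider "i = 1" "j = 1" | "i = 1" "j = 2" | "i = 1" "j = 3" | "i = 1" "4 \<le> j"
        | "i = 2" "j = 2" | "i = 2" "j = 3"
        using i small assms(2) disjunction(1) by linarith
      then show ?thesis
      proof cases
        case 1
        have "rung_pairs {0} {0} R = {}" by (auto simp: rung_pairs_def)
        then have "?P {0} {0}" using 1 by (simp add: restricts_empty)
        then show ?thesis by blast
      next
        case 2
        have "rung_pairs {\<alpha>} {\<alpha>, \<beta>} R = {}" using disjunction(3) by (auto simp: rung_pairs_def)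
        then have "?P {\<alpha>} {\<alpha>, \<beta>}" using 2 disjunction(2) by (simp add: restricts_empty)
        then show ?thesis by blast
      next
        case 3
        have "rung_pairs {\<alpha>} {\<alpha>, \<beta>, x} R \<subseteq> {(\<alpha>, x)}"
          using disjunction(3) by (auto simp: rung_pairs_def)
        then have "?P {\<alpha>} {\<alpha>, \<beta>, x}" using 3 x disjunction(1,2)
          by (auto intro: restricts_singleton)
        then show ?thesis by blast
      next
        case 4
        have "restricts (n + int i + int j - 5) (rung_pairs {\<alpha>} B R)"
          by (rule restricts_disjunction[where \<alpha> = \<alpha> and \<beta> = \<beta>])
            (use 4 disjunction(1,2) in \<open>auto simp: rung_pairs_def\<close>)
        then have "?P {\<alpha>} B" using 4 AB by auto
        then show ?thesis by blast
      next
        case 5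
        have "rung_pairs {\<alpha>, \<beta>} {\<alpha>, \<beta>} R \<subseteq> {(\<beta>, \<alpha>)}"
          using disjunction(3) by (auto simp: rung_pairs_def)
        then have "?P {\<alpha>, \<beta>} {\<alpha>, \<beta>}" using 5 disjunction(1,2)
          by (auto intro: restricts_singleton)
        then show ?thesis by blast
      next
        case 6
        have "restricts (n + int i + int j - 5) (rung_pairs {\<alpha>, \<beta>} {\<alpha>, \<beta>, x} R)"
          by (rule restricts_disjunction[where \<alpha> = \<beta> and \<beta> = x])
            (use 6 disjunction x in \<open>auto simp: rung_pairs_def\<close>)
        then have "?P {\<alpha>, \<beta>} {\<alpha>, \<beta>, x}" using 6 x disjunction(2) by auto
        then show ?thesis by blast
      qed
    next
      case trivial
      consider "i = 1" "j = 1" | "i = 1" "j = 2" | "i = 1" "3 \<le> j" | "i = 2" "j = 2"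
        using i small assms(2) trivial by linarith
      then show ?thesis
      proof cases
        case 1
        have "rung_pairs {0} {0} R = {}" by (auto simp: rung_pairs_def)
        then have "?P {0} {0}" using 1 by (simp add: restricts_empty)
        then show ?thesis by blast
      next
        case 2
        have "rung_pairs {0} {0, 1} R \<subseteq> {(0, 1)}" by (auto simp: rung_pairs_def)
        then have "?P {0} {0, 1}" using 2 trivial by (auto intro: restricts_singleton)
        then show ?thesis by blast
      next
        case 3
        have "restricts (n + int i + int j - 5) (rung_pairs {0} B R)"
          by (rule restricts_disjunction[where \<alpha> = 0 and \<beta> = 1])
            (use 3 trivial in \<open>auto simp: rung_pairs_def\<close>)
        then have "?P {0} B" using 3 AB by auto
        then show ?thesis by blast
      next
        case 4
        have "restricts (n + int i + int j - 5) (rung_pairs {0, 1} {0, 2} R)"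
          by (rule restricts_disjunction[where \<alpha> = 1 and \<beta> = 2])
            (use 4 trivial in \<open>auto simp: rung_pairs_def\<close>)
        then have "?P {0, 1} {0, 2}" using 4 by auto
        then show ?thesis by blast
      qed
    qed
  qed
qed

lemma restricts_rung_pairs:
  assumes "restricts n R"
  shows "\<exists>A B. finite A \<and> card A = i \<and> finite B \<and> card B = j \<and>
           restricts (n + int i + int j - 5) (rung_pairs A B R)"
proof (cases "i \<le> j")
  case True
  then show ?thesis using restricts_rung_pairs_ordered assms by blast
next
  case False
  then obtain A B where AB: "finite A" "card A = j" "finite B" "card B = i"
      "restricts (n + int j + int i - 5) (rung_pairs A B (R\<inverse>))"
    using restricts_rung_pairs_ordered[OF restricts_converse[OF assms], of j i] by auto
  from restricts_converse[OF AB(5)] have "restricts (n + int i + int j - 5) (rung_pairs B A R)"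
    by (simp add: rung_pairs_converse algebra_simps)
  with AB show ?thesis by blast
qed


section \<open>Excess and colorings of induced subgraphs\<close>

definition edges_in :: "'a ugraph \<Rightarrow> 'a set \<Rightarrow> 'a set set" where
  "edges_in G S = {e \<in> edges G. e \<subseteq> S}"

definition excess :: "'a ugraph \<Rightarrow> ('a \<Rightarrow> nat) \<Rightarrow> 'a set \<Rightarrow> int" where
  "excess G f S = (\<Sum>v \<in> S. int (f v)) - int (card S) - int (card (edges_in G S))"

definition colorings :: "'a ugraph \<Rightarrow> ('a \<Rightarrow> nat set) \<Rightarrow> 'a set \<Rightarrow> ('a \<Rightarrow> nat) set" where
  "colorings G L S =
     {c. (\<forall>u \<in> S. \<forall>v \<in> S. {u, v} \<in> edges G \<longrightarrow> c u \<noteq> c v) \<and> (\<forall>v \<in> S. c v \<in> L v)}"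

lemma simple_graph_loopless: "simple_graph G \<Longrightarrow> {x} \<notin> edges G"
  unfolding simple_graph_def by auto

lemma finite_edges: "simple_graph G \<Longrightarrow> finite (edges G)"
  unfolding simple_graph_def by (auto intro: finite_subset[of _ "Pow (verts G)"])

lemma edges_in_insert:
  assumes "simple_graph G"
  shows "edges_in G (insert x S) = edges_in G S \<union> (\<lambda>w. {x, w}) ` {w \<in> S. {x, w} \<in> edges G}"
proof -
  have "e \<in> (\<lambda>w. {x, w}) ` {w \<in> S. {x, w} \<in> edges G}"
    if e: "e \<in> edges G" "e \<subseteq> insert x S" "\<not> e \<subseteq> S" for e
  proof -
    obtain p q where "e = {p, q}" "p \<noteq> q"
      using assms e(1) unfolding simple_graph_def by (metis card_2_iff)
    with e obtain w where "e = {x, w}" "w \<in> S" by (auto simp: insert_commute)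
    with e(1) show ?thesis by auto
  qed
  then show ?thesis unfolding edges_in_def by auto
qed

lemma excess_insert:
  assumes "simple_graph G" "finite S" "x \<notin> S"
  shows "excess G f (insert x S) =
    excess G f S + int (f x) - 1 - int (card {w \<in> S. {x, w} \<in> edges G})"
proof -
  have "card (edges_in G (insert x S)) =
      card (edges_in G S) + card ((\<lambda>w. {x, w}) ` {w \<in> S. {x, w} \<in> edges G})"
    unfolding edges_in_insert[OF assms(1)]
  proof (rule card_Un_disjoint)
    show "finite (edges_in G S)" using finite_edges[OF assms(1)] by (simp add: edges_in_def)
  qed (use assms in \<open>auto simp: edges_in_def\<close>)
  moreover have "card ((\<lambda>w. {x, w}) ` {w \<in> S. {x, w} \<in> edges G}) = card {w \<in> S. {x, w} \<in> edges G}"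
    by (rule card_image) (auto simp: inj_on_def doubleton_eq_iff)
  ultimately show ?thesis using assms by (simp add: excess_def)
qed

lemma excess_cong: "(\<And>v. v \<in> S \<Longrightarrow> f v = g v) \<Longrightarrow> excess G f S = excess G g S"
  unfolding excess_def by simp

lemma colorings_mono: "S \<subseteq> T \<Longrightarrow> colorings G L T \<subseteq> colorings G L S"
  unfolding colorings_def by blast

lemma colorings_cong: "(\<And>v. v \<in> S \<Longrightarrow> L v = L' v) \<Longrightarrow> colorings G L S = colorings G L' S"
  unfolding colorings_def by auto

lemma fun_size_eq_excess:
  assumes "simple_graph G"
  shows "int (fun_size G f) = excess G f (verts G) + int (card (verts G) + card (edges G))"
proof -
  have "edges_in G (verts G) = edges G" using assms by (auto simp: edges_in_def simple_graph_def)
  then show ?thesis by (simp add: excess_def fun_size_def)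
qed

lemma list_colorable_iff:
  assumes "simple_graph G"
  shows "list_colorable G L \<longleftrightarrow> colorings G L (verts G) \<noteq> {}"
proof -
  have "proper_coloring G c \<longleftrightarrow>
      (\<forall>u \<in> verts G. \<forall>v \<in> verts G. {u, v} \<in> edges G \<longrightarrow> c u \<noteq> c v)" for c
    using assms unfolding proper_coloring_def simple_graph_def by (metis insert_subset)
  then show ?thesis by (auto simp: list_colorable_def colorings_def)
qed


section \<open>The greedy upper bound\<close>

text \<open>
  Each new vertex gets one color more than it has neighbors among the earlier vertices, so that
  coloring the vertices in the order of insertion never gets stuck.
\<close>
lemma ex_choice_excess_0:
  assumes "simple_graph G" "finite S"
  shows "\<exists>f. excess G f S = 0 \<and>
    (\<forall>L. (\<forall>v \<in> S. finite (L v) \<and> card (L v) = f v) \<longrightarrow> colorings G L S \<noteq> {})"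
  using assms(2)
proof induction
  case empty
  have "edges_in G {} = {}" using assms(1) by (auto simp: edges_in_def simple_graph_def)
  then show ?case by (simp add: excess_def colorings_def)
next
  case (insert x S)
  let ?N = "{w \<in> S. {x, w} \<in> edges G}"
  from insert.IH obtain f where f: "excess G f S = 0"
    "\<And>L. \<forall>v \<in> S. finite (L v) \<and> card (L v) = f v \<Longrightarrow> colorings G L S \<noteq> {}" by blast
  define g where "g = f(x := Suc (card ?N))"
  have "excess G g S = excess G f S"
    using insert.hyps by (intro excess_cong) (auto simp: g_def)
  then have "excess G g (insert x S) = 0"
    using excess_insert[OF assms(1) insert.hyps, of g] f(1) by (simp add: g_def)
  moreover have "colorings G L (insert x S) \<noteq> {}"
    if L: "\<forall>v \<in> insert x S. finite (L v) \<and> card (L v) = g v" for L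
  proof -
    have "\<forall>v \<in> S. finite (L v) \<and> card (L v) = f v"
      using L insert.hyps by (auto simp: g_def)
    then obtain c where c: "c \<in> colorings G L S" using f(2) by blast
    have "card (c ` ?N) < card (L x)"
      using L card_image_le[of ?N c] insert.hyps by (simp add: g_def)
    then have "\<not> L x \<subseteq> c ` ?N"
      using card_mono[of "c ` ?N" "L x"] insert.hyps by auto
    then obtain a where a: "a \<in> L x" "a \<notin> c ` ?N" by blast
    have "{w, x} = {x, w}" for w by auto
    then have "c(x := a) \<in> colorings G L (insert x S)"
      using a c insert.hyps simple_graph_loopless[OF assms(1)] by (auto simp: colorings_def)
    then show ?thesis by blast
  qed
  ultimately show ?case by blast
qed


section \<open>Extending a controlled frontier\<close>

text \<open>
  The invariant of the sweep: \<open>S\<close> is the swept part and \<open>u\<close>, \<open>v\<close> are its frontier vertices.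
\<close>
definition controlled ::
    "'a ugraph \<Rightarrow> ('a \<Rightarrow> nat) \<Rightarrow> 'a set \<Rightarrow> 'a \<Rightarrow> 'a \<Rightarrow> bool" where
  "controlled G f S u v \<longleftrightarrow>
     (\<exists>L. (\<forall>w \<in> S. finite (L w) \<and> card (L w) = f w) \<and>
        restricts (excess G f S) ((\<lambda>c. (c u, c v)) ` colorings G L S))"

lemma controlled_sym:
  assumes "controlled G f S u v"
  shows "controlled G f S v u"
proof -
  from assms obtain L where L: "\<forall>w \<in> S. finite (L w) \<and> card (L w) = f w"
    and R: "restricts (excess G f S) ((\<lambda>c. (c u, c v)) ` colorings G L S)"
    unfolding controlled_def by blast
  have "((\<lambda>c. (c u, c v)) ` colorings G L S)\<inverse> = (\<lambda>c. (c v, c u)) ` colorings G L S" by auto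
  then have "restricts (excess G f S) ((\<lambda>c. (c v, c u)) ` colorings G L S)"
    using restricts_converse[OF R] by simp
  with L show ?thesis unfolding controlled_def by blast
qed

lemma controlled_extend:
  assumes "simple_graph G" "finite S" "x \<notin> S" "u \<in> S" "v \<in> S"
    and nbr: "\<And>w. w \<in> S \<Longrightarrow> {x, w} \<in> edges G \<longleftrightarrow> w = u"
    and ctrl: "controlled G f S u v"
  shows "controlled G f (insert x S) x v"
proof -
  from ctrl obtain L where L: "\<forall>w \<in> S. finite (L w) \<and> card (L w) = f w"
    and R: "restricts (excess G f S) ((\<lambda>c. (c u, c v)) ` colorings G L S)" (is "restricts _ ?R")
    unfolding controlled_def by blast
  obtain A where A: "finite A" "card A = f x"
    and RA: "restricts (excess G f S + int (f x) - 2) (extend_pairs A ?R)"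
    using restricts_extend_pairs[OF R] by blast
  let ?L = "L(x := A)"
  have "{w \<in> S. {x, w} \<in> edges G} = {u}" using assms(4) nbr by auto
  then have exc: "excess G f (insert x S) = excess G f S + int (f x) - 2"
    using excess_insert[OF assms(1-3), of f] by simp
  have "(\<lambda>c. (c x, c v)) ` colorings G ?L (insert x S) \<subseteq> extend_pairs A ?R"
  proof
    fix r assume "r \<in> (\<lambda>c. (c x, c v)) ` colorings G ?L (insert x S)"
    then obtain c where c: "c \<in> colorings G ?L (insert x S)" and r: "r = (c x, c v)" by blast
    have "colorings G ?L S = colorings G L S"
      using assms(3) by (intro colorings_cong) auto
    then have "c \<in> colorings G L S" using c colorings_mono[of S "insert x S"] by blast
    moreover have "c x \<in> A" "c x \<noteq> c u"
      using c assms(4) nbr by (auto simp: colorings_def)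
    ultimately show "r \<in> extend_pairs A ?R" unfolding r extend_pairs_def by force
  qed
  then have "restricts (excess G f (insert x S))
      ((\<lambda>c. (c x, c v)) ` colorings G ?L (insert x S))"
    using RA exc restricts_mono by simp
  moreover have "\<forall>w \<in> insert x S. finite (?L w) \<and> card (?L w) = f w" using L A by auto
  ultimately show ?thesis unfolding controlled_def by blast
qed

text \<open>
  The frontier vertex \<open>hd ys\<close> moves along \<open>ys\<close>, one vertex at a time, while \<open>v\<close> stays in place.
\<close>
lemma controlled_extend_path:
  assumes "simple_graph G" "finite S" "v \<in> S" "ys \<noteq> []" "distinct ys" "hd ys \<in> S"
    and new: "set (tl ys) \<inter> S = {}"
    and nbr: "\<And>i w. Suc i < length ys \<Longrightarrow> w \<in> S \<union> set (take (Suc i) ys) \<Longrightarrow>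
      {ys ! Suc i, w} \<in> edges G \<longleftrightarrow> w = ys ! i"
    and ctrl: "controlled G f S (hd ys) v"
  shows "controlled G f (S \<union> set ys) (last ys) v"
proof -
  have "controlled G f (S \<union> set (take (Suc i) ys)) (ys ! i) v" if "i < length ys" for i
    using that
  proof (induction i)
    case 0
    have "S \<union> set (take (Suc 0) ys) = S" using assms(4,6) by (cases ys) auto
    then show ?case using ctrl assms(4) by (simp add: hd_conv_nth)
  next
    case (Suc i)
    let ?T = "S \<union> set (take (Suc i) ys)"
    have T: "S \<union> set (take (Suc (Suc i)) ys) = insert (ys ! Suc i) ?T"
      using Suc.prems by (auto simp: take_Suc_conv_app_nth)
    have "ys ! Suc i \<notin> set (take (Suc i) ys)"
      using Suc.prems assms(5) by (auto simp: in_set_conv_nth nth_eq_iff_index_eq)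
    moreover have "ys ! Suc i \<in> set (tl ys)"
      using Suc.prems nth_tl[of i ys] nth_mem[of i "tl ys"] by simp
    ultimately have "ys ! Suc i \<notin> ?T" using new by auto
    moreover have "ys ! i \<in> ?T"
      using Suc.prems by (auto simp: in_set_conv_nth intro!: exI[of _ i])
    ultimately show ?case unfolding T
      using controlled_extend[OF assms(1), of ?T "ys ! Suc i" "ys ! i" v f]
        assms(2,3) Suc nbr by auto
  qed
  from this[of "length ys - 1"] show ?thesis using assms(4) by (simp add: last_conv_nth)
qed

lemma controlled_rung:
  assumes "simple_graph G" "finite S" "x \<notin> S" "y \<notin> S" "u \<in> S" "v \<in> S"
    and edge: "{x, y} \<in> edges G"
    and nbr_x: "\<And>w. w \<in> S \<Longrightarrow> {x, w} \<in> edges G \<longleftrightarrow> w = u"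
    and nbr_y: "\<And>w. w \<in> S \<Longrightarrow> {y, w} \<in> edges G \<longleftrightarrow> w = v"
    and ctrl: "controlled G f S u v"
  shows "controlled G f (S \<union> {x, y}) x y"
proof -
  from ctrl obtain L where L: "\<forall>w \<in> S. finite (L w) \<and> card (L w) = f w"
    and R: "restricts (excess G f S) ((\<lambda>c. (c u, c v)) ` colorings G L S)" (is "restricts _ ?R")
    unfolding controlled_def by blast
  obtain A B where AB: "finite A" "card A = f x" "finite B" "card B = f y"
    and RAB: "restricts (excess G f S + int (f x) + int (f y) - 5) (rung_pairs A B ?R)"
    using restricts_rung_pairs[OF R] by blast
  have neq: "x \<noteq> y" using edge simple_graph_loopless[OF assms(1)] by auto
  let ?L = "L(x := A, y := B)"
  let ?S = "insert y (insert x S)"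
  have "{w \<in> S. {x, w} \<in> edges G} = {u}" using assms(5) nbr_x by auto
  moreover have "{w \<in> insert x S. {y, w} \<in> edges G} = {x, v}"
    using assms(6) nbr_y edge by (auto simp: insert_commute)
  moreover have "x \<noteq> v" using assms(3,6) by auto
  ultimately have exc: "excess G f ?S = excess G f S + int (f x) + int (f y) - 5"
    using excess_insert[OF assms(1-3), of f] excess_insert[OF assms(1), of "insert x S" y f]
      assms(2-4) neq by simp
  have "(\<lambda>c. (c x, c y)) ` colorings G ?L ?S \<subseteq> rung_pairs A B ?R"
  proof
    fix r assume "r \<in> (\<lambda>c. (c x, c y)) ` colorings G ?L ?S"
    then obtain c where c: "c \<in> colorings G ?L ?S" and r: "r = (c x, c y)" by blast
    have "colorings G ?L S = colorings G L S"
      using assms(3,4) by (intro colorings_cong) auto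
    then have "c \<in> colorings G L S" using c colorings_mono[of S ?S] by blast
    moreover have "c x \<in> A" "c y \<in> B" "c x \<noteq> c y" "c x \<noteq> c u" "c y \<noteq> c v"
      using c assms(5,6) nbr_x nbr_y edge neq by (auto simp: colorings_def)
    ultimately show "r \<in> rung_pairs A B ?R" unfolding r rung_pairs_def
      by (auto intro!: bexI[of _ c])
  qed
  then have "restricts (excess G f ?S) ((\<lambda>c. (c x, c y)) ` colorings G ?L ?S)"
    using RAB exc restricts_mono by simp
  moreover have "\<forall>w \<in> ?S. finite (?L w) \<and> card (?L w) = f w" using L AB neq by auto
  ultimately have "controlled G f ?S x y" unfolding controlled_def by blast
  moreover have "?S = S \<union> {x, y}" by auto
  ultimately show ?thesis by simp
qed

text \<open>
  The sweep starts with a rung put onto an imaginary frontier without any restriction and with excess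
  2: the rung then contributes \<open>f x + f y - 5\<close>, and the sum is the excess \<open>f x + f y - 3\<close> of an edge.
\<close>
lemma controlled_edge:
  assumes "simple_graph G" "{x, y} \<in> edges G"
  shows "controlled G f {x, y} x y"
proof -
  have neq: "x \<noteq> y" using assms simple_graph_loopless by fastforce
  obtain A B where AB: "finite A" "card A = f x" "finite B" "card B = f y"
    and RAB: "restricts (2 + int (f x) + int (f y) - 5) (rung_pairs A B UNIV)"
    using restricts_rung_pairs[OF restricts_trivial[OF order_refl, of UNIV]] by blast
  let ?L = "\<lambda>w. if w = x then A else B"
  have "edges_in G {x, y} = {{x, y}}"
  proof -
    have "e = {x, y}" if "e \<in> edges G" "e \<subseteq> {x, y}" for e
      using that assms(1) neq unfolding simple_graph_def by (intro card_subset_eq) auto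
    then show ?thesis using assms(2) by (auto simp: edges_in_def)
  qed
  then have exc: "excess G f {x, y} = 2 + int (f x) + int (f y) - 5"
    using neq by (simp add: excess_def)
  have "(\<lambda>c. (c x, c y)) ` colorings G ?L {x, y} \<subseteq> rung_pairs A B UNIV"
  proof
    fix r assume "r \<in> (\<lambda>c. (c x, c y)) ` colorings G ?L {x, y}"
    then obtain c where c: "c \<in> colorings G ?L {x, y}" and r: "r = (c x, c y)" by blast
    have "c x \<in> A" "c y \<in> B" "c x \<noteq> c y" using c assms(2) neq by (auto simp: colorings_def)
    \<comment> \<open>The imaginary frontier can always be given colors that do not interfere.\<close>
    moreover have "\<exists>(p, q) \<in> UNIV. p \<noteq> c x \<and> q \<noteq> c y"
      by (rule bexI[of _ "(Suc (c x), Suc (c y))"]) simp_all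
    ultimately show "r \<in> rung_pairs A B UNIV" unfolding r rung_pairs_def by simp
  qed
  then have "restricts (excess G f {x, y}) ((\<lambda>c. (c x, c y)) ` colorings G ?L {x, y})"
    unfolding exc by (rule restricts_mono[OF RAB])
  moreover have "\<forall>w \<in> {x, y}. finite (?L w) \<and> card (?L w) = f w" using AB neq by auto
  ultimately show ?thesis unfolding controlled_def by (intro exI[of _ ?L] conjI)
qed

lemma excess_nonneg:
  assumes "simple_graph G" "choice_function G f" "controlled G f (verts G) u v"
  shows "0 \<le> excess G f (verts G)"
proof (rule ccontr)
  assume "\<not> ?thesis"
  then have neg: "excess G f (verts G) \<le> -1" by simp
  from assms(3) obtain L where L: "list_assignment G f L"
    and "restricts (excess G f (verts G)) ((\<lambda>c. (c u, c v)) ` colorings G L (verts G))"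
    unfolding controlled_def list_assignment_def by blast
  with neg have "colorings G L (verts G) = {}" by (simp add: restricts_def)
  then show False
    using L assms(2) list_colorable_iff[OF assms(1)] by (auto simp: choice_function_def)
qed


section \<open>Traversing a cycle\<close>

text \<open>
  A cycle can be listed such that a given edge closes it, that is, joins the last vertex to the first.
\<close>
lemma cycle_graph_from_edge:
  assumes "cycle_graph n C" "e \<in> edges C"
  obtains xs where "length xs = n" "distinct xs" "set xs = verts C" "e = {xs ! 0, xs ! (n - 1)}"
    "edges C = {{xs ! i, xs ! (Suc i mod n)} | i. i < n}"
proof -
  from assms(1) obtain ys where ys: "n \<ge> 3" "length ys = n" "distinct ys" "verts C = set ys"
    "edges C = {{ys ! j, ys ! (Suc j mod n)} | j. j < n}"
    unfolding cycle_graph_def by blast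
  with assms(2) obtain j where j: "j < n" "e = {ys ! j, ys ! (Suc j mod n)}" by auto
  define xs where "xs = rotate (Suc j) ys"
  have nth: "xs ! i = ys ! ((Suc j + i) mod n)" if "i < n" for i
    using that ys(2) by (simp only: xs_def nth_rotate)
  have edge: "{xs ! i, xs ! (Suc i mod n)} =
      {ys ! ((Suc j + i) mod n), ys ! (Suc ((Suc j + i) mod n) mod n)}" if "i < n" for i
  proof -
    have "Suc i mod n < n" using ys(1) by simp
    moreover have "(Suc j + Suc i mod n) mod n = Suc ((Suc j + i) mod n) mod n"
      by (simp only: mod_add_right_eq mod_Suc_eq add_Suc_right)
    ultimately show ?thesis using that by (simp only: nth)
  qed
  have "edges C = {{xs ! i, xs ! (Suc i mod n)} | i. i < n}" (is "_ = ?E")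
  proof
    show "edges C \<subseteq> ?E"
    proof
      fix d assume "d \<in> edges C"
      then obtain m where m: "m < n" "d = {ys ! m, ys ! (Suc m mod n)}" using ys(5) by blast
      let ?i = "(m + (n - Suc j)) mod n"
      have "(Suc j + ?i) mod n = m"
      proof -
        have "(Suc j + ?i) mod n = (Suc j + (m + (n - Suc j))) mod n" by (rule mod_add_right_eq)
        also have "Suc j + (m + (n - Suc j)) = m + n" using j(1) by simp
        finally show ?thesis using m(1) by simp
      qed
      moreover have i: "?i < n" using ys(1) by simp
      ultimately have "d = {xs ! ?i, xs ! (Suc ?i mod n)}" using m(2) edge[of ?i] by simp
      with i show "d \<in> ?E" by blast
    qed
    show "?E \<subseteq> edges C"
    proof
      fix d assume "d \<in> ?E"
      then obtain i where "i < n" "d = {xs ! i, xs ! (Suc i mod n)}" by blast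
      with edge[of i] have "d = {ys ! ((Suc j + i) mod n), ys ! (Suc ((Suc j + i) mod n) mod n)}"
        by simp
      moreover have "(Suc j + i) mod n < n" using ys(1) by simp
      ultimately show "d \<in> edges C" unfolding ys(5) by blast
    qed
  qed
  moreover have "e = {xs ! 0, xs ! (n - 1)}"
    using nth[of 0] nth[of "n - 1"] j ys(1) by (auto simp: insert_commute)
  ultimately show thesis
    using that[of xs] ys by (auto simp: xs_def)
qed

lemma cycle_neighbours:
  assumes "length xs = n" "distinct xs" "E = {{xs ! i, xs ! (Suc i mod n)} | i. i < n}"
    and i: "Suc (Suc i) < n"
  shows "{xs ! Suc i, w} \<in> E \<longleftrightarrow> w = xs ! i \<or> w = xs ! Suc (Suc i)"
proof
  assume "{xs ! Suc i, w} \<in> E"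
  then obtain m where m: "m < n" "{xs ! Suc i, w} = {xs ! m, xs ! (Suc m mod n)}"
    unfolding assms(3) by blast
  then consider "xs ! Suc i = xs ! m" "w = xs ! (Suc m mod n)"
    | "xs ! Suc i = xs ! (Suc m mod n)" "w = xs ! m"
    by (auto simp: doubleton_eq_iff)
  then show "w = xs ! i \<or> w = xs ! Suc (Suc i)"
  proof cases
    case 1
    then have "Suc i = m" using assms m(1) nth_eq_iff_index_eq[of xs "Suc i" m] by simp
    then show ?thesis using 1(2) i by simp
  next
    case 2
    have "Suc m mod n < n" using i by simp
    then have "Suc i = Suc m mod n"
      using 2(1) assms nth_eq_iff_index_eq[of xs "Suc i" "Suc m mod n"] by simp
    then have "i = m" using m(1) by (cases "Suc m = n") auto
    then show ?thesis using 2(2) by simp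
  qed
next
  assume "w = xs ! i \<or> w = xs ! Suc (Suc i)"
  moreover have "{xs ! i, xs ! (Suc i mod n)} \<in> E" "{xs ! Suc i, xs ! (Suc (Suc i) mod n)} \<in> E"
    unfolding assms(3) using i Suc_lessD by blast+
  ultimately show "{xs ! Suc i, w} \<in> E" using i by (auto simp: insert_commute)
qed

lemma cycle_graph_edges_nonempty:
  assumes "cycle_graph n C"
  shows "edges C \<noteq> {}"
proof -
  from assms obtain xs where "3 \<le> n" "edges C = {{xs ! j, xs ! (Suc j mod n)} | j. j < n}"
    unfolding cycle_graph_def by blast
  then have "{xs ! 0, xs ! (Suc 0 mod n)} \<in> edges C" by force
  then show ?thesis by blast
qed

text \<open>The bound on the length is needed because any two edges of a triangle share a vertex.\<close>
lemma ex_disjoint_edge: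
  assumes "cycle_graph n C" "4 \<le> n" "e \<in> edges C"
  shows "\<exists>e' \<in> edges C. e \<inter> e' = {}"
proof -
  obtain xs where xs: "length xs = n" "distinct xs" "set xs = verts C"
    "e = {xs ! 0, xs ! (n - 1)}" "edges C = {{xs ! i, xs ! (Suc i mod n)} | i. i < n}"
    by (rule cycle_graph_from_edge[OF assms(1,3)])
  have "{xs ! Suc 0, xs ! Suc (Suc 0)} \<in> edges C"
    using cycle_neighbours[OF xs(1,2,5)] assms(2) by simp
  moreover have "e \<inter> {xs ! Suc 0, xs ! Suc (Suc 0)} = {}"
    using xs(1,2,4) assms(2) by (auto simp: nth_eq_iff_index_eq)
  ultimately show ?thesis by blast
qed

text \<open>
  The frontier moves across a cycle from the edge \<open>e\<close> to a disjoint edge \<open>e'\<close>. Removing both edges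
  leaves two paths, each starting in an end of \<open>e\<close> and finishing in an end of \<open>e'\<close>. The frontier
  vertices move along these paths until they are next to \<open>e'\<close>, which is then added as a rung.
\<close>
lemma controlled_cycle:
  assumes "simple_graph G" "finite S" "cycle_graph n C" "edges C \<subseteq> edges G"
    and e: "e \<in> edges C" "e' \<in> edges C" "e \<inter> e' = {}" "S \<inter> verts C = e"
    and local: "\<And>x w. x \<in> verts C - S \<Longrightarrow> w \<in> S \<union> verts C \<Longrightarrow> {x, w} \<in> edges G \<Longrightarrow>
      {x, w} \<in> edges C"
    and ctrl: "\<exists>u v. e = {u, v} \<and> controlled G f S u v"
  shows "\<exists>u v. e' = {u, v} \<and> controlled G f (S \<union> verts C) u v"
proof -
  obtain xs where xs: "length xs = n" "distinct xs" "set xs = verts C" "e = {xs ! 0, xs ! (n - 1)}"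
    "edges C = {{xs ! i, xs ! (Suc i mod n)} | i. i < n}"
    by (rule cycle_graph_from_edge[OF assms(3) e(1)])
  obtain j where j: "j < n" "e' = {xs ! j, xs ! (Suc j mod n)}" using e(2) xs(5) by auto
  have "xs ! j \<noteq> xs ! 0" "xs ! j \<noteq> xs ! (n - 1)" "xs ! (Suc j mod n) \<noteq> xs ! (n - 1)"
    using e(3) j(2) unfolding xs(4) by auto
  moreover from this have "Suc j < n" using j(1) by (cases "Suc j = n") auto
  ultimately have "j \<noteq> 0" "j \<noteq> n - 1" "Suc j \<noteq> n - 1" by (metis mod_less)+
  with j(1) have bounds: "0 < j" "Suc (Suc j) < n" by auto
  have e': "e' = {xs ! j, xs ! Suc j}" using j(2) bounds by simp
  have ctrl0: "controlled G f S (xs ! 0) (xs ! (n - 1))"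
  proof -
    from ctrl obtain u v where "e = {u, v}" "controlled G f S u v" by blast
    then show ?thesis using controlled_sym xs(4) by (auto simp: doubleton_eq_iff)
  qed
  have eq_iff: "xs ! i = xs ! m \<longleftrightarrow> i = m" if "i < n" "m < n" for i m
    using that xs(1,2) by (simp add: nth_eq_iff_index_eq)
  have mem_S: "xs ! i \<in> S \<longleftrightarrow> i = 0 \<or> i = n - 1" if "i < n" for i
  proof -
    have "xs ! i \<in> S \<longleftrightarrow> xs ! i \<in> e" using that e(4) xs(1,3) nth_mem by blast
    then show ?thesis using that eq_iff by (auto simp: xs(4))
  qed
  have mem_take: "xs ! i \<in> set (take m xs) \<longleftrightarrow> i < m" if "i < n" for i m
    using that eq_iff xs(1) by (auto simp: in_set_conv_nth)
  have mem_drop: "xs ! i \<in> set (drop m xs) \<longleftrightarrow> m \<le> i" if "i < n" for i m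
  proof
    assume "xs ! i \<in> set (drop m xs)"
    then obtain l where "l < length (drop m xs)" "drop m xs ! l = xs ! i"
      unfolding in_set_conv_nth by blast
    then show "m \<le> i" using that eq_iff[of "m + l" i] xs(1) by auto
  next
    assume "m \<le> i"
    then have "drop m xs ! (i - m) = xs ! i" "i - m < length (drop m xs)" using that xs(1) by auto
    then show "xs ! i \<in> set (drop m xs)" by (metis nth_mem)
  qed
  have nbr: "{xs ! Suc i, w} \<in> edges G \<longleftrightarrow> w = xs ! i \<or> w = xs ! Suc (Suc i)"
    if i: "Suc (Suc i) < n" and w: "w \<in> S \<union> set xs" for i w
  proof -
    have "xs ! Suc i \<in> set xs" using i xs(1) by simp
    moreover have "xs ! Suc i \<notin> S" using i mem_S[of "Suc i"] by simp
    ultimately have "{xs ! Suc i, w} \<in> edges G \<longleftrightarrow> {xs ! Suc i, w} \<in> edges C"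
      using local[of "xs ! Suc i" w] w assms(4) unfolding xs(3) by blast
    then show ?thesis using cycle_neighbours[OF xs(1,2,5) i] by simp
  qed
  \<comment> \<open>The two paths without their last vertices, which are the ends of \<open>e'\<close>.\<close>
  let ?ys = "take j xs" and ?zs = "rev (drop (Suc (Suc j)) xs)"
  have nonempty: "?ys \<noteq> []" "?zs \<noteq> []" using bounds xs(1) by auto
  have hd_ys: "hd ?ys = xs ! 0" using hd_conv_nth[OF nonempty(1)] bounds by simp
  have top: "controlled G f (S \<union> set ?ys) (last ?ys) (xs ! (n - 1))"
  proof (rule controlled_extend_path)
    show "set (tl ?ys) \<inter> S = {}"
    proof -
      have "xs ! Suc i \<notin> S" if "Suc i < j" for i using that bounds mem_S[of "Suc i"] by simp
      then show ?thesis using bounds xs(1) by (auto simp: in_set_conv_nth nth_tl)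
    qed
    show "{?ys ! Suc i, w} \<in> edges G \<longleftrightarrow> w = ?ys ! i"
      if "Suc i < length ?ys" "w \<in> S \<union> set (take (Suc i) ?ys)" for i w
    proof -
      have i: "Suc i < j" using that(1) by simp
      have "xs ! Suc (Suc i) \<notin> S \<union> set (take (Suc i) ?ys)"
        using i bounds mem_S mem_take by (simp add: min_def)
      moreover have "w \<in> S \<union> set xs" using that(2) by (auto dest: in_set_takeD)
      ultimately show ?thesis using that(2) i bounds nbr[of i w] by auto
    qed
    show "hd ?ys \<in> S" "controlled G f S (hd ?ys) (xs ! (n - 1))"
      unfolding hd_ys using bounds ctrl0 mem_S[of 0] by simp_all
  qed (use assms bounds xs mem_S in auto)
  have last_ys: "last ?ys = xs ! (j - 1)" using last_conv_nth[OF nonempty(1)] bounds xs(1) by simp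
  let ?T = "S \<union> set ?ys"
  have nth_zs: "?zs ! i = xs ! (n - 1 - i)" if "i < n - Suc (Suc j)" for i
  proof -
    have "Suc (Suc j) + (n - Suc (Suc j) - Suc i) = n - 1 - i" using that by simp
    then show ?thesis using that xs(1) by (simp only: rev_nth length_drop nth_drop)
  qed
  have hd_zs: "hd ?zs = xs ! (n - 1)"
    using hd_conv_nth[OF nonempty(2)] nth_zs[of 0] bounds by simp
  have bot: "controlled G f (?T \<union> set ?zs) (last ?zs) (xs ! (j - 1))"
  proof (rule controlled_extend_path)
    have T: "xs ! i \<in> ?T \<longleftrightarrow> i < j \<or> i = n - 1" if "i < n" for i
      using that bounds mem_S mem_take by auto
    show "set (tl ?zs) \<inter> ?T = {}"
    proof -
      have "?zs ! Suc i \<notin> ?T" if "Suc i < n - Suc (Suc j)" for i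
      proof -
        have "n - 1 - Suc i < n" "j \<le> n - 1 - Suc i" "n - 1 - Suc i \<noteq> n - 1" using that by auto
        then show ?thesis unfolding nth_zs[OF that] using T by simp
      qed
      then show ?thesis using bounds xs(1) by (auto simp: in_set_conv_nth nth_tl)
    qed
    show "{?zs ! Suc i, w} \<in> edges G \<longleftrightarrow> w = ?zs ! i"
      if "Suc i < length ?zs" "w \<in> ?T \<union> set (take (Suc i) ?zs)" for i w
    proof -
      have i: "Suc i < n - Suc (Suc j)" using that(1) xs(1) by simp
      define m where "m = n - 1 - Suc (Suc i)"
      have m: "Suc j \<le> m" "Suc (Suc m) < n" "?zs ! Suc i = xs ! Suc m" "?zs ! i = xs ! Suc (Suc m)"
        using i bounds nth_zs by (auto simp: m_def Suc_diff_Suc)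
      have "xs ! m \<notin> set (take (Suc i) ?zs)"
      proof
        assume "xs ! m \<in> set (take (Suc i) ?zs)"
        then obtain l where "l < Suc i" "xs ! m = ?zs ! l" using i xs(1) by (auto simp: in_set_conv_nth)
        then show False using i m nth_zs[of l] eq_iff[of m "n - 1 - l"] by (auto simp: m_def)
      qed
      then have "xs ! m \<notin> ?T \<union> set (take (Suc i) ?zs)" using m T[of m] by auto
      moreover have "w \<in> S \<union> set xs"
        using that(2) set_take_subset[of "Suc i" ?zs] set_take_subset[of j xs]
          set_drop_subset[of "Suc (Suc j)" xs] by auto
      ultimately show ?thesis using that(2) m nbr[of m w] by auto
    qed
    show "hd ?zs \<in> ?T" "controlled G f ?T (hd ?zs) (xs ! (j - 1))"
      unfolding hd_zs using bounds T[of "n - 1"] controlled_sym[OF top] last_ys by simp_all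
    show "xs ! (j - 1) \<in> ?T" using bounds T[of "j - 1"] by simp
  qed (use assms bounds xs in auto)
  have last_zs: "last ?zs = xs ! Suc (Suc j)"
    using last_conv_nth[OF nonempty(2)] nth_zs[of "n - Suc (Suc (Suc j))"] bounds xs(1)
    by (simp add: Suc_diff_Suc)
  let ?U = "?T \<union> set ?zs"
  have U: "xs ! i \<in> ?U \<longleftrightarrow> i \<noteq> j \<and> i \<noteq> Suc j" if "i < n" for i
    using that bounds mem_S[of i] mem_take[of i j] mem_drop[of i "Suc (Suc j)"] by auto
  have sub: "?U \<subseteq> S \<union> set xs" by (auto dest: in_set_takeD in_set_dropD)
  have "controlled G f (?U \<union> {xs ! j, xs ! Suc j}) (xs ! j) (xs ! Suc j)"
  proof (rule controlled_rung)
    show "{xs ! j, xs ! Suc j} \<in> edges G" using e(2) e' assms(4) by blast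
    show "{xs ! j, w} \<in> edges G \<longleftrightarrow> w = xs ! (j - 1)" if "w \<in> ?U" for w
      using that sub nbr[of "j - 1" w] bounds U[of "Suc j"] by auto
    show "{xs ! Suc j, w} \<in> edges G \<longleftrightarrow> w = xs ! Suc (Suc j)" if "w \<in> ?U" for w
      using that sub nbr[of j w] bounds U[of j] by auto
    show "controlled G f ?U (xs ! (j - 1)) (xs ! Suc (Suc j))"
      using controlled_sym[OF bot] last_zs by simp
  qed (use assms bounds U in auto)
  moreover have "?U \<union> {xs ! j, xs ! Suc j} = S \<union> verts C"
  proof -
    have "x \<in> ?U \<union> {xs ! j, xs ! Suc j}" if "x \<in> set xs" for x
    proof -
      from that obtain i where "i < n" "x = xs ! i" using xs(1) by (auto simp: in_set_conv_nth)
      then show ?thesis using U[of i] by auto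
    qed
    moreover have "xs ! j \<in> set xs" "xs ! Suc j \<in> set xs" using bounds xs(1) by auto
    ultimately show ?thesis using sub xs(3) by blast
  qed
  ultimately show ?thesis using e' by auto
qed


section \<open>Paths of cycles\<close>

text \<open>
  The cycles are crossed in order. Cycle \<open>i\<close> is entered through \<open>{t i, b i}\<close> and left through
  \<open>{t (i + 1), b (i + 1)}\<close>; the edge at which the sweep starts in the first cycle and the edge at which
  it stops in the last one are arbitrary apart from being disjoint from the other edge in use.
\<close>
lemma path_of_cycles_controlled:
  assumes "simple_graph G" "k \<ge> 1" "path_of_cycles k G"
  shows "\<exists>u v. controlled G f (verts G) u v"
proof -
  from assms(3) obtain C :: "nat \<Rightarrow> 'a ugraph" and a t b where
    vG: "verts G = (\<Union>i \<in> {1..k}. verts (C i))" and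
    eG: "edges G = (\<Union>i \<in> {1..k}. edges (C i))" and
    cyc: "\<forall>i \<in> {1..k}. a i \<ge> 4 \<and> cycle_graph (a i) (C i)" and
    vint: "\<forall>i \<in> {2..k}. t i \<noteq> b i \<and> verts (C (i - 1)) \<inter> verts (C i) = {t i, b i}" and
    eint: "\<forall>i \<in> {2..k}. edges (C (i - 1)) \<inter> edges (C i) = {{t i, b i}}" and
    tb: "\<forall>i \<in> {2..k}. \<forall>j \<in> {1..k} - {i - 1, i}. t i \<notin> verts (C j) \<and> b i \<notin> verts (C j)" and
    inner: "\<forall>i \<in> {1..k}. \<forall>w \<in> verts (C i) - (\<Union>l \<in> {i, i + 1} \<inter> {2..k}. {t l, b l}).
           \<forall>j \<in> {1..k} - {i}. w \<notin> verts (C j)"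
    unfolding path_of_cycles_def by (elim conjE exE) (rule that)
  have edge_verts: "w \<in> verts (C i)" if "d \<in> edges (C i)" "w \<in> d" "i \<in> {1..k}" for d w i
  proof -
    from cyc that(3) obtain n xs where "n \<ge> 3" "length xs = n" "verts (C i) = set xs"
      "edges (C i) = {{xs ! j, xs ! (Suc j mod n)} | j. j < n}"
      unfolding cycle_graph_def by blast
    moreover from this have "Suc j mod n < length xs" for j by simp
    ultimately show ?thesis using that(1,2) nth_mem by fastforce
  qed
  \<comment> \<open>Only consecutive cycles share vertices.\<close>
  have consec: "l = Suc m"
    if w: "w \<in> verts (C m)" "w \<in> verts (C l)" and ml: "1 \<le> m" "m < l" "l \<le> k" for w m l
  proof (rule ccontr)
    assume neq: "l \<noteq> Suc m"
    show False
    proof (cases "w \<in> (\<Union>l \<in> {m, m + 1} \<inter> {2..k}. {t l, b l})")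
      case True
      then obtain i where "i \<in> {m, m + 1} \<inter> {2..k}" "w \<in> {t i, b i}" by (rule UN_E)
      then have i: "i = m \<or> i = Suc m" "i \<in> {2..k}" "w = t i \<or> w = b i" by auto
      then have "l \<in> {1..k} - {i - 1, i}" using ml neq by auto
      with tb i(2,3) w(2) show False by blast
    next
      case False
      have "m \<in> {1..k}" "l \<in> {1..k} - {m}" using ml by auto
      then have "w \<notin> verts (C l)" using inner DiffI[OF w(1) False] by blast
      with w(2) show False by blast
    qed
  qed
  have disj: "{t i, b i} \<inter> {t (Suc i), b (Suc i)} = {}" if "2 \<le> i" "Suc i \<le> k" for i
  proof -
    have "{t i, b i} \<subseteq> verts (C (i - 1))" using vint that by fastforce
    moreover have "{t (Suc i), b (Suc i)} \<subseteq> verts (C (Suc i))" using vint that by fastforce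
    moreover have "w \<notin> verts (C (Suc i))" if "w \<in> verts (C (i - 1))" for w
    proof
      assume "w \<in> verts (C (Suc i))"
      moreover have "1 \<le> i - 1" "i - 1 < Suc i" using \<open>2 \<le> i\<close> by auto
      ultimately have "Suc i = Suc (i - 1)" using consec[OF that] \<open>Suc i \<le> k\<close> by blast
      then show False using \<open>2 \<le> i\<close> by simp
    qed
    ultimately show ?thesis by blast
  qed
  have joint: "{t i, b i} \<in> edges (C (i - 1))" "{t i, b i} \<in> edges (C i)" if "i \<in> {2..k}" for i
    using eint that by blast+
  define V where "V i = (\<Union>l \<in> {1..i}. verts (C l))" for i
  have V_Suc: "V (Suc i) = V i \<union> verts (C (Suc i))" for i
  proof -
    have "{1..Suc i} = insert (Suc i) {1..i}" by auto
    then show ?thesis by (auto simp: V_def)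
  qed
  have finV: "finite (V i)" if "i \<le> k" for i
  proof -
    have "V i \<subseteq> verts G" unfolding V_def vG by (rule UN_mono) (use that in auto)
    moreover have "finite (verts G)" using assms(1) by (simp add: simple_graph_def)
    ultimately show ?thesis by (rule finite_subset)
  qed
  \<comment> \<open>A new vertex of cycle \<open>i\<close> may also lie on cycle \<open>i + 1\<close>. An edge of that cycle joining it to
    a vertex of the first \<open>i\<close> cycles can only be the shared edge, which belongs to cycle \<open>i\<close> as well.\<close>
  have local: "{x, w} \<in> edges (C i)"
    if i: "1 \<le> i" "i \<le> k" and x: "x \<in> verts (C i)" "x \<notin> V (i - 1)"
      and w: "w \<in> V i" and xw: "{x, w} \<in> edges G" for i x w
  proof -
    from xw obtain l where l: "l \<in> {1..k}" "{x, w} \<in> edges (C l)" unfolding eG by blast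
    then have xl: "x \<in> verts (C l)" and wl: "w \<in> verts (C l)" using edge_verts by blast+
    have "\<not> l < i"
    proof
      assume "l < i"
      then have "l \<in> {1..i - 1}" using l(1) by auto
      then show False using x(2) xl unfolding V_def by blast
    qed
    then consider "l = i" | "i < l" by linarith
    then show ?thesis
    proof cases
      case 1
      then show ?thesis using l(2) by simp
    next
      case 2
      then have li: "l = Suc i" using consec[OF x(1) xl] i(1) l(1) by simp
      from w obtain m where m: "1 \<le> m" "m \<le> i" "w \<in> verts (C m)" unfolding V_def by auto
      then have "m = i" using consec[OF m(3) wl] l(1) li by simp
      then have "{x, w} \<subseteq> verts (C (l - 1)) \<inter> verts (C l)" using m(3) wl x(1) xl li by simp
      moreover have l2: "l \<in> {2..k}" using l(1) li i(1) by simp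
      ultimately have "{x, w} \<subseteq> {t l, b l}" using vint by blast
      moreover have "x \<noteq> w" using xw simple_graph_loopless[OF assms(1)] by auto
      ultimately have "{x, w} = {t l, b l}" by auto
      then show ?thesis using joint(1)[OF l2] li by simp
    qed
  qed
  have step: "\<exists>u v. e' = {u, v} \<and> controlled G f (S \<union> verts (C i)) u v"
    if i: "1 \<le> i" "i \<le> k" and S: "finite S" "V (i - 1) \<subseteq> S" "S \<subseteq> V i" "S \<inter> verts (C i) = e"
      and e: "e \<in> edges (C i)" "e' \<in> edges (C i)" "e \<inter> e' = {}"
      and ctrl: "\<exists>u v. e = {u, v} \<and> controlled G f S u v" for i S e e'
  proof (rule controlled_cycle[OF assms(1) S(1) _ _ e S(4) _ ctrl])
    show "cycle_graph (a i) (C i)" using cyc i by simp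
    show "edges (C i) \<subseteq> edges G" using eG i by auto
    fix x w assume "x \<in> verts (C i) - S" "w \<in> S \<union> verts (C i)" "{x, w} \<in> edges G"
    moreover have "verts (C i) \<subseteq> V i" unfolding V_def using i(1) by (intro UN_upper) simp
    ultimately show "{x, w} \<in> edges (C i)" using local[OF i, of x w] S(2,3) by blast
  qed
  \<comment> \<open>In the first cycle the swept part is initially just the edge at which the sweep starts.\<close>
  have first: "\<exists>u v. e' = {u, v} \<and> controlled G f (V 1) u v" if e': "e' \<in> edges (C 1)" for e'
  proof -
    obtain e where e: "e \<in> edges (C 1)" "e \<inter> e' = {}"
      using ex_disjoint_edge[of "a 1" "C 1" e'] cyc e' assms(2) by (auto simp: Int_commute)
    have eG1: "e \<in> edges G" unfolding eG using e(1) assms(2) by (intro UN_I[of 1]) simp_all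
    then obtain u v where uv: "e = {u, v}" using assms(1) unfolding simple_graph_def
      by (metis card_2_iff)
    have ctrl: "\<exists>u v. e = {u, v} \<and> controlled G f e u v"
      using controlled_edge[OF assms(1)] eG1 unfolding uv by blast
    have V1: "V 1 = verts (C 1)" "V (1 - 1) = {}" by (simp_all add: V_def)
    have sub: "e \<subseteq> verts (C 1)" using edge_verts[OF e(1)] assms(2) by auto
    have "\<exists>u v. e' = {u, v} \<and> controlled G f (e \<union> verts (C 1)) u v"
      by (rule step[OF _ _ _ _ _ _ e(1) e' e(2) ctrl])
        (use V1 sub assms(2) uv in \<open>auto simp del: One_nat_def\<close>)
    then show ?thesis using V1 sub by (simp add: Un_absorb1)
  qed
  have meet: "V i \<inter> verts (C (Suc i)) = {t (Suc i), b (Suc i)}" if "1 \<le> i" "Suc i \<le> k" for i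
  proof -
    have "verts (C i) \<inter> verts (C (Suc i)) = {t (Suc i), b (Suc i)}"
      using bspec[OF vint, of "Suc i"] that by simp
    moreover have "w \<in> verts (C i)" if w: "w \<in> V i" "w \<in> verts (C (Suc i))" for w
    proof -
      from w(1) obtain m where m: "1 \<le> m" "m \<le> i" "w \<in> verts (C m)" unfolding V_def by auto
      then have "m = i" using consec[OF m(3) w(2)] \<open>Suc i \<le> k\<close> by simp
      with m(3) show ?thesis by simp
    qed
    moreover have "verts (C i) \<subseteq> V i" unfolding V_def using that(1) by (intro UN_upper) simp
    ultimately show ?thesis by blast
  qed
  have all: "\<exists>u v. e' = {u, v} \<and> controlled G f (V i) u v"
    if "1 \<le> i" "i \<le> k" "e' \<in> edges (C i)" "i = 1 \<or> {t i, b i} \<inter> e' = {}" for i e'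
    using that
  proof (induction i arbitrary: e' rule: nat_induct_at_least)
    case base
    then show ?case using first by simp
  next
    case (Suc i)
    let ?e = "{t (Suc i), b (Suc i)}"
    have i: "1 \<le> i" "Suc i \<le> k" "Suc i \<in> {2..k}" using Suc.hyps Suc.prems by auto
    have "i = 1 \<or> {t i, b i} \<inter> ?e = {}" using disj[of i] i by (cases "i = 1") simp_all
    then have ctrl: "\<exists>u v. ?e = {u, v} \<and> controlled G f (V i) u v"
      using Suc.IH[of ?e] i joint(1)[OF i(3)] by simp
    have disj': "?e \<inter> e' = {}" using Suc.prems i(1) by auto
    have "\<exists>u v. e' = {u, v} \<and> controlled G f (V i \<union> verts (C (Suc i))) u v"
      by (rule step[OF _ _ _ _ _ meet[OF i(1,2)] joint(2)[OF i(3)] Suc.prems(2) disj' ctrl])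
        (use i finV V_Suc in auto)
    then show ?case by (simp only: V_Suc)
  qed
  have cyc_k: "cycle_graph (a k) (C k)" "4 \<le> a k" using cyc assms(2) by auto
  have "\<exists>e' \<in> edges (C k). k = 1 \<or> {t k, b k} \<inter> e' = {}"
  proof (cases "k = 1")
    case True
    then show ?thesis using cycle_graph_edges_nonempty[OF cyc_k(1)] by auto
  next
    case False
    then have "k \<in> {2..k}" using assms(2) by simp
    then show ?thesis using ex_disjoint_edge[OF cyc_k joint(2)] by blast
  qed
  then obtain u v where "controlled G f (V k) u v" using all[OF assms(2) order_refl] by blast
  moreover have "V k = verts G" by (simp add: V_def vG)
  ultimately show ?thesis by auto
qed

theorem theorem5p1:
  fixes G :: "'a ugraph" and k :: nat
  assumes "simple_graph G"
    and "k \<ge> 1"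
    and "path_of_cycles k G"
  shows "sc_greedy G"
proof -
  have "finite (verts G)" using assms(1) by (simp add: simple_graph_def)
  then obtain f where exc: "excess G f (verts G) = 0"
    and f: "\<And>L. list_assignment G f L \<Longrightarrow> colorings G L (verts G) \<noteq> {}"
    using ex_choice_excess_0[OF assms(1)] unfolding list_assignment_def by meson
  have "choice_function G f"
    using f list_colorable_iff[OF assms(1)] by (simp add: choice_function_def)
  moreover have "fun_size G f = card (verts G) + card (edges G)"
    using fun_size_eq_excess[OF assms(1), of f] exc by linarith
  moreover have "card (verts G) + card (edges G) \<le> fun_size G g" if "choice_function G g" for g
    using path_of_cycles_controlled[OF assms, of g] excess_nonneg[OF assms(1) that]
      fun_size_eq_excess[OF assms(1), of g] by fastforce
  ultimately show ?thesis
    unfolding sc_greedy_def sum_choice_number_def by (intro Least_equality) auto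
qed

end
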